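(* Let $\mathcal{A}$ be a unital associative algebra over a field $F$ containing a nonzero nilpotent element with nilpotency index $2$ (i.e. an element $e\neq 0$ with $e^2=0$), and let $f \in F[x]$ be a polynomial. If the evaluation map $\mathrm{eva}_{f,\mathcal{A}}$ is injective, then for every $\lambda \in F$, the polynomial $f - \lambda$ has only simple roots in $F$ (that is, every root of $f-\lambda$ lying in $F$ has multiplicity $1$).
   Context: For $f \in F[x]$ and a unital associative $F$-algebra $\mathcal{A}$ with identity $\mathbf{1}_{\mathcal{A}}$, the evaluation map $\mathrm{eva}_{f,\mathcal{A}} : \mathcal{A} \to \mathcal{A}$ is $a\mapsto f(a)$, where a constant term $c\in F$ is interpreted as $c\,\mathbf{1}_{\mathcal{A}}$. *)

theory Defs
  imports "HOL-Computational_Algebra.Polynomial"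
begin

(* The library's algebra locale (HOL-Algebra.Module) requires a commutative multiplication and
   real_algebra_1 fixes the ground field, hence this locale. The algebra is the whole type 'a. *)
locale unital_algebra = vector_space scale
  for scale :: "'f::field \<Rightarrow> 'a::ring_1 \<Rightarrow> 'a" +
  assumes scale_mult_left: "scale c x * y = scale c (x * y)"
    and scale_mult_right: "x * scale c y = scale c (x * y)"

(* The summand for i = 0 is scale (coeff f 0) 1: the constant term acts as a multiple of the identity. *)
definition eva :: "('f::field \<Rightarrow> 'a::ring_1 \<Rightarrow> 'a) \<Rightarrow> 'f poly \<Rightarrow> 'a \<Rightarrow> 'a" where
  "eva scale f a = (\<Sum>i\<le>degree f. scale (coeff f i) (a ^ i))"

end

theory Submission
  imports Defs
begin

text \<open>
  A square-zero element \<open>e\<close> behaves like an infinitesimal: Taylor expansion around a scalar \<open>r\<close>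
  stops after the linear term, so \<open>f(r + e) = f(r) + f'(r) e\<close> (lemma \<open>eva_scalar_plus_square_zero\<close>).
  If \<open>f'(r)\<close> were \<open>0\<close>, then \<open>f\<close> would take the same value at the points \<open>r\<close> and \<open>r + e\<close>, which
  differ because \<open>e \<noteq> 0\<close>; so injectivity of the evaluation map forces \<open>f'(r) \<noteq> 0\<close> for every
  scalar \<open>r\<close>. The polynomials \<open>f\<close> and \<open>f - \<lambda>\<close> have the same derivative, and a root at which the
  derivative does not vanish is simple.
\<close>

context unital_algebra
begin

lemma eva_0 [simp]: "eva scale 0 a = 0"
  by (simp add: eva_def)

lemma eva_pCons: "eva scale (pCons c p) a = scale c 1 + a * eva scale p a"
proof (cases "p = 0")
  case True
  then show ?thesis by (simp add: eva_def)
next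
  case False
  then have "eva scale (pCons c p) a
      = scale c 1 + (\<Sum>i\<le>degree p. scale (coeff p i) (a * a ^ i))"
    by (simp add: eva_def sum.atMost_Suc_shift del: sum.atMost_Suc)
  also have "\<dots> = scale c 1 + a * eva scale p a"
    by (simp add: eva_def sum_distrib_left scale_mult_right)
  finally show ?thesis .
qed

text \<open>
  Horner's scheme reduces the expansion to an induction on the polynomial: multiplying \<open>p(r) + p'(r) e\<close> by
  \<open>r + e\<close> reproduces the product rule \<open>(x p)' = p + x p'\<close>, since the only other term,
  \<open>p'(r) e\<^sup>2\<close>, vanishes.
\<close>
lemma eva_scalar_plus_square_zero:
  assumes "e * e = 0"
  shows "eva scale p (scale r 1 + e) = scale (poly p r) 1 + scale (poly (pderiv p) r) e"
proof (induction p)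
  case 0
  then show ?case by simp
next
  case (pCons c p)
  then show ?case
    using assms
    by (simp add: eva_pCons pderiv_pCons algebra_simps scale_mult_left scale_mult_right
        scale_left_distrib scale_right_distrib)
qed

lemma poly_pderiv_nonzero_if_inj_eva:
  fixes e :: 'a
  assumes inj: "inj (eva scale f)" and e: "e \<noteq> 0" "e * e = 0"
  shows "poly (pderiv f) r \<noteq> 0"
proof
  assume "poly (pderiv f) r = 0"
  then have "eva scale f (scale r 1 + e) = eva scale f (scale r 1 + 0)"
    using eva_scalar_plus_square_zero[of e f r] eva_scalar_plus_square_zero[of 0 f r] e by simp
  then have "scale r 1 + e = scale r 1 + 0"
    using inj by (rule injD[rotated])
  with e show False by simp
qed

end

text \<open>
  This direction of the derivative test holds in every characteristic: if \<open>(x - r)\<^sup>2\<close> divides \<open>p\<close>,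
  then \<open>x - r\<close> divides \<open>p'\<close>.
\<close>
lemma order_eq_1_if_pderiv_nonzero:
  fixes p :: "'f::field poly"
  assumes root: "poly p r = 0" and deriv: "poly (pderiv p) r \<noteq> 0"
  shows "order r p = 1"
proof -
  have "p \<noteq> 0" using deriv by auto
  then have "order r p \<noteq> 0" using root by (simp add: order_root)
  moreover have "\<not> 2 \<le> order r p"
  proof
    assume "2 \<le> order r p"
    then have "[:-r, 1:] ^ 2 dvd p" using \<open>p \<noteq> 0\<close> by (simp add: order_divides)
    then obtain q where "p = [:-r, 1:] * ([:-r, 1:] * q)"
      unfolding power2_eq_square mult.assoc[symmetric] by (rule dvdE)
    then have "poly (pderiv p) r = 0" by (simp only: pderiv_mult) simp
    with deriv show False by contradiction
  qed
  ultimately show ?thesis by linarith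
qed

theorem theorem3p2:
  fixes scale :: "'f::field \<Rightarrow> 'a::ring_1 \<Rightarrow> 'a"
    and f :: "'f poly"
  assumes "unital_algebra scale"
    and "\<exists>e::'a. e \<noteq> 0 \<and> e ^ 2 = 0"
    and "inj (eva scale f)"
  shows "\<forall>l::'f. \<forall>r::'f. poly (f - [:l:]) r = 0 \<longrightarrow> order r (f - [:l:]) = 1"
proof (intro allI impI)
  fix l r :: 'f
  assume root: "poly (f - [:l:]) r = 0"
  obtain e :: 'a where "e \<noteq> 0" "e * e = 0"
    using assms(2) by (auto simp: power2_eq_square)
  then have "poly (pderiv f) r \<noteq> 0"
    by (rule unital_algebra.poly_pderiv_nonzero_if_inj_eva[OF assms(1) assms(3)])
  then have "poly (pderiv (f - [:l:])) r \<noteq> 0"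
    by (simp add: pderiv_diff pderiv_pCons)
  with root show "order r (f - [:l:]) = 1"
    by (rule order_eq_1_if_pderiv_nonzero)
qed

end
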